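(* Let $d_1,d_2\in\mathbb{N}$, $k\geq 1$, and let $\Phi:\mathbb{M}_{d_1}\to\mathbb{M}_{d_2}$ be a $k$-positive linear map. Then the following conditions are equivalent: (i) $\Phi$ is $k$-entanglement breaking. (ii) $(\Phi\otimes\mathrm{id}_k)(X)$ is separable for all $X\in(\mathbb{M}_{d_1}\otimes\mathbb{M}_k)^+$.
   Context: $\mathbb{M}_d$ is the algebra of complex $d\times d$ matrices; a superscript $+$ denotes the cone of positive semidefinite matrices; $\mathrm{id}_k$ is the identity map on $\mathbb{M}_k$. A linear map $\Phi:\mathbb{M}_{d_1}\to\mathbb{M}_{d_2}$ is $k$-positive if $\mathrm{id}_k\otimes\Phi$ maps positive semidefinite matrices to positive semidefinite matrices. $X\in(\mathbb{M}_{m}\otimes\mathbb{M}_{n})^+$ is separable if $X=\sum_i A_i\otimes B_i$ (finite sum) with $A_i\in\mathbb{M}_m^+$, $B_i\in\mathbb{M}_n^+$. $\Phi$ is $k$-entanglement breaking if it is $k$-positive and $(\mathrm{id}_k\otimes\Phi)(X)$ is separable for every $X\in(\mathbb{M}_k\otimes\mathbb{M}_{d_1})^+$. *)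

theory Defs
  imports "Jordan_Normal_Form.VS_Connect"
begin

text \<open>The algebra of complex \<open>d \<times> d\<close> matrices, seen as a complex vector space;
  its carrier is \<^term>\<open>carrier_mat d d\<close>.\<close>

abbreviation matrix_space :: "nat \<Rightarrow> (complex, complex mat) module" where
  "matrix_space d \<equiv> module_mat TYPE(complex) d d"

text \<open>On complex numbers \<open>0 \<le> z\<close> says that \<open>z\<close> is real and nonnegative, so the condition
  forces \<open>A\<close> to be Hermitian.\<close>

definition psd :: "nat \<Rightarrow> complex mat set" where
  "psd d = {A \<in> carrier_mat d d. \<forall>v \<in> carrier_vec d. 0 \<le> (A *\<^sub>v v) \<bullet>c v}"

text \<open>\<open>\<complex>\<^sup>m \<otimes> \<complex>\<^sup>n\<close> is identified with \<open>\<complex>\<^sup>m\<^sup>n\<close> by sending \<open>e\<^sub>i \<otimes> e\<^sub>p\<close> to \<open>e\<^sub>i\<^sub>n\<^sub>+\<^sub>p\<close>. This identifies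
  the tensor product of the matrix algebras of sizes \<open>m\<close> and \<open>n\<close> with the matrices of size
  \<open>m * n\<close>, elementary tensors being Kronecker products.\<close>

definition kron :: "complex mat \<Rightarrow> complex mat \<Rightarrow> complex mat" (infixl \<open>\<otimes>\<^sub>K\<close> 70) where
  "A \<otimes>\<^sub>K B = mat (dim_row A * dim_row B) (dim_col A * dim_col B)
     (\<lambda>(r, s). A $$ (r div dim_row B, s div dim_col B) * B $$ (r mod dim_row B, s mod dim_col B))"

definition matrix_unit :: "nat \<Rightarrow> nat \<Rightarrow> nat \<Rightarrow> complex mat" where
  "matrix_unit d i j = mat d d (\<lambda>p. if p = (i, j) then 1 else 0)"

text \<open>\<open>\<Phi> \<otimes> \<Psi>\<close> for linear \<open>\<Phi>\<close> from size \<open>a\<close> to size \<open>b\<close> and \<open>\<Psi>\<close> from size \<open>c\<close> to size \<open>d\<close>, given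
  on the basis \<open>E\<^sub>i\<^sub>j \<otimes> E\<^sub>p\<^sub>q\<close> by \<open>\<Phi>(E\<^sub>i\<^sub>j) \<otimes> \<Psi>(E\<^sub>p\<^sub>q)\<close>.\<close>

definition tensor_map :: "nat \<Rightarrow> nat \<Rightarrow> (complex mat \<Rightarrow> complex mat) \<Rightarrow>
    nat \<Rightarrow> nat \<Rightarrow> (complex mat \<Rightarrow> complex mat) \<Rightarrow> complex mat \<Rightarrow> complex mat" where
  "tensor_map a b \<Phi> c d \<Psi> X =
    finsum (matrix_space (b * d))
      (\<lambda>(i, j, p, q). X $$ (i * c + p, j * c + q) \<cdot>\<^sub>m
         (\<Phi> (matrix_unit a i j) \<otimes>\<^sub>K \<Psi> (matrix_unit c p q)))
      ({..<a} \<times> {..<a} \<times> {..<c} \<times> {..<c})"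

definition separable :: "nat \<Rightarrow> nat \<Rightarrow> complex mat set" where
  "separable m n = {X \<in> psd (m * n). \<exists>(N :: nat) A B.
     (\<forall>i<N. A i \<in> psd m \<and> B i \<in> psd n) \<and>
     X = (\<Oplus>\<^bsub>matrix_space (m * n)\<^esub> i \<in> {..<N}. A i \<otimes>\<^sub>K B i)}"

definition k_positive :: "nat \<Rightarrow> nat \<Rightarrow> nat \<Rightarrow> (complex mat \<Rightarrow> complex mat) \<Rightarrow> bool" where
  "k_positive k d1 d2 \<Phi> \<longleftrightarrow> (\<forall>X \<in> psd (k * d1). tensor_map k k id d1 d2 \<Phi> X \<in> psd (k * d2))"

definition k_entanglement_breaking ::
    "nat \<Rightarrow> nat \<Rightarrow> nat \<Rightarrow> (complex mat \<Rightarrow> complex mat) \<Rightarrow> bool" where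
  "k_entanglement_breaking k d1 d2 \<Phi> \<longleftrightarrow> k_positive k d1 d2 \<Phi> \<and>
     (\<forall>X \<in> psd (k * d1). tensor_map k k id d1 d2 \<Phi> X \<in> separable k d2)"

text \<open>\<open>tensor_map\<close> acts on elementary tensors as it should.\<close>

lemma matrix_unit_carrier [simp]: "matrix_unit d i j \<in> carrier_mat d d"
  by (simp add: matrix_unit_def)

lemma kron_carrier:
  "A \<in> carrier_mat m m \<Longrightarrow> B \<in> carrier_mat n n \<Longrightarrow> A \<otimes>\<^sub>K B \<in> carrier_mat (m * n) (m * n)"
  by (auto simp: kron_def)

lemma finsum_mat_closed:
  assumes "finite I" "\<And>i. i \<in> I \<Longrightarrow> f i \<in> carrier_mat d d"
  shows "(\<Oplus>\<^bsub>matrix_space d\<^esub> i \<in> I. f i) \<in> carrier_mat d d"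
proof -
  interpret abelian_group "matrix_space d" by (rule abelian_group_mat)
  show ?thesis using finsum_closed[of f I] assms by (auto simp: module_mat_simps)
qed

lemma index_finsum_mat:
  assumes "finite I" "\<And>i. i \<in> I \<Longrightarrow> f i \<in> carrier_mat d d" "r < d" "s < d"
  shows "(\<Oplus>\<^bsub>matrix_space d\<^esub> i \<in> I. f i) $$ (r, s) = (\<Sum>i\<in>I. f i $$ (r, s))"
proof -
  interpret abelian_group "matrix_space d" by (rule abelian_group_mat)
  show ?thesis using assms(1,2)
  proof (induction I)
    case empty
    then show ?case using assms(3,4) by (simp add: module_mat_simps)
  next
    case (insert x F)
    have c: "(\<Oplus>\<^bsub>matrix_space d\<^esub> i \<in> F. f i) \<in> carrier_mat d d"
      using insert by (intro finsum_mat_closed) auto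
    have "(\<Oplus>\<^bsub>matrix_space d\<^esub> i \<in> insert x F. f i) = f x + (\<Oplus>\<^bsub>matrix_space d\<^esub> i \<in> F. f i)"
      using insert by (subst finsum_insert) (auto simp: module_mat_simps)
    then show ?case using insert c assms(3,4) by simp
  qed
qed

lemma linear_map_matrix_unit_expansion:
  assumes lin: "linear_map class_ring (matrix_space a) (matrix_space b) \<Phi>"
    and A: "A \<in> carrier_mat a a" and rs: "r < b" "s < b"
  shows "\<Phi> A $$ (r, s) = (\<Sum>(i, j) \<in> {..<a} \<times> {..<a}. A $$ (i, j) * \<Phi> (matrix_unit a i j) $$ (r, s))"
proof -
  interpret V: abelian_group "matrix_space a" by (rule abelian_group_mat)
  interpret L: linear_map class_ring "matrix_space a" "matrix_space b" \<Phi> by (rule lin)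
  have cl: "\<Phi> X \<in> carrier_mat b b" if "X \<in> carrier_mat a a" for X
    using L.T_im that by (simp add: module_mat_simps)
  have sm: "\<Phi> (z \<cdot>\<^sub>m X) = z \<cdot>\<^sub>m \<Phi> X" if "X \<in> carrier_mat a a" for X z
    using L.T_smult[of z X] that by (simp add: module_mat_simps)
  have ad: "\<Phi> (X + Y) = \<Phi> X + \<Phi> Y" if "X \<in> carrier_mat a a" "Y \<in> carrier_mat a a" for X Y
    using L.T_add[of X Y] that by (simp add: module_mat_simps)
  define t where "t = (\<lambda>p. A $$ p \<cdot>\<^sub>m matrix_unit a (fst p) (snd p))"
  have t: "t p \<in> carrier_mat a a" for p by (simp add: t_def)
  have gen: "\<Phi> (\<Oplus>\<^bsub>matrix_space a\<^esub> p \<in> I. t p) $$ (r, s) = (\<Sum>p\<in>I. \<Phi> (t p) $$ (r, s))"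
    if "finite I" for I
    using that
  proof (induction I)
    case empty
    have "\<Phi> (0\<^sub>m a a) = 0 \<cdot>\<^sub>m \<Phi> (0\<^sub>m a a)" using sm[of "0\<^sub>m a a" 0] by simp
    moreover have "\<Phi> (0\<^sub>m a a) \<in> carrier_mat b b" by (intro cl) simp
    ultimately have "\<Phi> (0\<^sub>m a a) $$ (r, s) = 0"
      using rs by (metis carrier_matD index_smult_mat(1) mult_zero_left)
    then show ?case by (simp add: module_mat_simps)
  next
    case (insert x F)
    have c: "(\<Oplus>\<^bsub>matrix_space a\<^esub> p \<in> F. t p) \<in> carrier_mat a a"
      using insert t by (intro finsum_mat_closed) auto
    have e: "(\<Oplus>\<^bsub>matrix_space a\<^esub> p \<in> insert x F. t p) = t x + (\<Oplus>\<^bsub>matrix_space a\<^esub> p \<in> F. t p)"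
      using insert t by (subst V.finsum_insert) (auto simp: module_mat_simps)
    show ?case unfolding e ad[OF t c] using insert cl[OF c] rs by simp
  qed
  have "A = (\<Oplus>\<^bsub>matrix_space a\<^esub> p \<in> {..<a} \<times> {..<a}. t p)"
  proof (rule eq_matI)
    have c: "(\<Oplus>\<^bsub>matrix_space a\<^esub> p \<in> {..<a} \<times> {..<a}. t p) \<in> carrier_mat a a"
      using t by (intro finsum_mat_closed) auto
    then show "dim_row A = dim_row (\<Oplus>\<^bsub>matrix_space a\<^esub> p \<in> {..<a} \<times> {..<a}. t p)"
      and "dim_col A = dim_col (\<Oplus>\<^bsub>matrix_space a\<^esub> p \<in> {..<a} \<times> {..<a}. t p)" using A by auto
    fix i j assume "i < dim_row (\<Oplus>\<^bsub>matrix_space a\<^esub> p \<in> {..<a} \<times> {..<a}. t p)"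
      "j < dim_col (\<Oplus>\<^bsub>matrix_space a\<^esub> p \<in> {..<a} \<times> {..<a}. t p)"
    then have ij: "i < a" "j < a" using c by auto
    have "(\<Sum>p \<in> {..<a} \<times> {..<a}. t p $$ (i, j)) =
        (\<Sum>p \<in> {..<a} \<times> {..<a}. if (i, j) = p then A $$ p else 0)"
      using ij by (intro sum.cong) (auto simp: t_def matrix_unit_def)
    also have "\<dots> = A $$ (i, j)" using ij by (subst sum.delta') auto
    finally show "A $$ (i, j) = (\<Oplus>\<^bsub>matrix_space a\<^esub> p \<in> {..<a} \<times> {..<a}. t p) $$ (i, j)"
      using ij t by (subst index_finsum_mat) auto
  qed
  then have "\<Phi> A $$ (r, s) = (\<Sum>p \<in> {..<a} \<times> {..<a}. \<Phi> (t p) $$ (r, s))"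
    using gen[of "{..<a} \<times> {..<a}"] by simp
  also have "\<dots> = (\<Sum>(i, j) \<in> {..<a} \<times> {..<a}. A $$ (i, j) * \<Phi> (matrix_unit a i j) $$ (r, s))"
    using rs by (intro sum.cong) (auto simp: t_def sm carrier_matD[OF cl])
  finally show ?thesis .
qed

lemma tensor_map_kron:
  assumes \<Phi>: "linear_map class_ring (matrix_space a) (matrix_space b) \<Phi>"
    and \<Psi>: "linear_map class_ring (matrix_space c) (matrix_space d) \<Psi>"
    and A: "A \<in> carrier_mat a a" and B: "B \<in> carrier_mat c c"
  shows "tensor_map a b \<Phi> c d \<Psi> (A \<otimes>\<^sub>K B) = \<Phi> A \<otimes>\<^sub>K \<Psi> B"
proof -
  interpret L: linear_map class_ring "matrix_space a" "matrix_space b" \<Phi> by (rule \<Phi>)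
  interpret M: linear_map class_ring "matrix_space c" "matrix_space d" \<Psi> by (rule \<Psi>)
  have p: "\<Phi> X \<in> carrier_mat b b" if "X \<in> carrier_mat a a" for X
    using L.T_im that by (simp add: module_mat_simps)
  have q: "\<Psi> X \<in> carrier_mat d d" if "X \<in> carrier_mat c c" for X
    using M.T_im that by (simp add: module_mat_simps)
  let ?I = "{..<a} \<times> {..<a} \<times> {..<c} \<times> {..<c}"
  let ?f = "\<lambda>(i, j, k, l). (A \<otimes>\<^sub>K B) $$ (i * c + k, j * c + l) \<cdot>\<^sub>m
      (\<Phi> (matrix_unit a i j) \<otimes>\<^sub>K \<Psi> (matrix_unit c k l))"
  have f: "?f x \<in> carrier_mat (b * d) (b * d)" for x
    using p q by (auto split: prod.split intro!: smult_carrier_mat kron_carrier)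
  have K: "\<Phi> A \<otimes>\<^sub>K \<Psi> B \<in> carrier_mat (b * d) (b * d)" using A B p q by (intro kron_carrier)
  have T: "tensor_map a b \<Phi> c d \<Psi> (A \<otimes>\<^sub>K B) \<in> carrier_mat (b * d) (b * d)"
    unfolding tensor_map_def by (rule finsum_mat_closed) (use f in auto)
  have lt: "i * c + k < a * c" if "i < a" "k < c" for i k
  proof -
    have "i * c + k < Suc i * c" using that by simp
    also have "\<dots> \<le> a * c" using that by (intro mult_le_mono1) simp
    finally show ?thesis .
  qed
  show ?thesis
  proof (rule eq_matI)
    fix r s assume "r < dim_row (\<Phi> A \<otimes>\<^sub>K \<Psi> B)" "s < dim_col (\<Phi> A \<otimes>\<^sub>K \<Psi> B)"
    then have rs: "r < b * d" "s < b * d" using K by auto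
    then have "d > 0" by (cases d) auto
    then have rs': "r div d < b" "s div d < b" "r mod d < d" "s mod d < d"
      using rs by (auto simp: less_mult_imp_div_less)
    have "tensor_map a b \<Phi> c d \<Psi> (A \<otimes>\<^sub>K B) $$ (r, s) = (\<Sum>x\<in>?I. ?f x $$ (r, s))"
      unfolding tensor_map_def by (rule index_finsum_mat) (use f rs in auto)
    also have "\<dots> = (\<Sum>(i, j, k, l)\<in>?I.
        (A $$ (i, j) * \<Phi> (matrix_unit a i j) $$ (r div d, s div d)) *
        (B $$ (k, l) * \<Psi> (matrix_unit c k l) $$ (r mod d, s mod d)))"
      using A B rs lt
      by (intro sum.cong)
        (auto simp: kron_def carrier_matD[OF p] carrier_matD[OF q] mult_ac)
    also have "\<dots> =
        (\<Sum>(i, j) \<in> {..<a} \<times> {..<a}. A $$ (i, j) * \<Phi> (matrix_unit a i j) $$ (r div d, s div d)) *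
        (\<Sum>(k, l) \<in> {..<c} \<times> {..<c}. B $$ (k, l) * \<Psi> (matrix_unit c k l) $$ (r mod d, s mod d))"
      by (simp add: sum.cartesian_product[symmetric] sum_distrib_right)
        (simp add: sum_distrib_left)
    also have "\<dots> = \<Phi> A $$ (r div d, s div d) * \<Psi> B $$ (r mod d, s mod d)"
      using linear_map_matrix_unit_expansion[OF \<Phi> A rs'(1,2)]
        linear_map_matrix_unit_expansion[OF \<Psi> B rs'(3,4)] by simp
    also have "\<dots> = (\<Phi> A \<otimes>\<^sub>K \<Psi> B) $$ (r, s)"
      using rs p[OF A] q[OF B] by (auto simp: kron_def)
    finally show "tensor_map a b \<Phi> c d \<Psi> (A \<otimes>\<^sub>K B) $$ (r, s) = (\<Phi> A \<otimes>\<^sub>K \<Psi> B) $$ (r, s)" .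
  qed (use K T in auto)
qed

end

theory Submission
  imports Defs
begin

text \<open>The two conditions are exchanged by the flip \<open>x \<otimes> y \<mapsto> y \<otimes> x\<close>. On matrices over
  \<open>\<complex>\<^sup>m \<otimes> \<complex>\<^sup>n\<close> the flip is the simultaneous permutation of rows and columns by a bijection of
  the indices, that is, conjugation by a permutation matrix. As such it preserves positive
  semidefiniteness, and it sends \<open>A \<otimes> B\<close> to \<open>B \<otimes> A\<close>; hence it preserves separability
  (lemma \<open>flip_separable\<close>). It also intertwines \<open>\<Phi> \<otimes> \<Psi>\<close> with \<open>\<Psi> \<otimes> \<Phi>\<close>
  (lemma \<open>flip_tensor_map\<close>). So \<open>(\<Phi> \<otimes> id)(X)\<close> is the flip of \<open>(id \<otimes> \<Phi>)(X')\<close>, where \<open>X'\<close> is the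
  flip of \<open>X\<close>, and as the flip is an involution, \<open>X\<close> and \<open>X'\<close> determine each other.\<close>

text \<open>The index of \<open>e\<^sub>p \<otimes> e\<^sub>i\<close> in \<open>\<complex>\<^sup>n \<otimes> \<complex>\<^sup>m\<close>, which is \<open>p * m + i\<close>, goes to the index \<open>i * n + p\<close> of
  \<open>e\<^sub>i \<otimes> e\<^sub>p\<close> in \<open>\<complex>\<^sup>m \<otimes> \<complex>\<^sup>n\<close>.\<close>

definition flip_index :: "nat \<Rightarrow> nat \<Rightarrow> nat \<Rightarrow> nat" where
  "flip_index m n r = (r mod m) * n + r div m"

definition flip :: "nat \<Rightarrow> nat \<Rightarrow> complex mat \<Rightarrow> complex mat" where
  "flip m n X = mat (n * m) (n * m) (\<lambda>(r, s). X $$ (flip_index m n r, flip_index m n s))"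

lemma tensor_index_less:
  fixes i p m n :: nat
  assumes "i < m" "p < n"
  shows "i * n + p < m * n"
proof -
  have "i * n + p < Suc i * n" using assms by simp
  also have "\<dots> \<le> m * n" using assms by (intro mult_le_mono1) simp
  finally show ?thesis .
qed

lemma div_mod_less:
  fixes r m n :: nat
  assumes "r < n * m"
  shows "r div m < n" "r mod m < m"
proof -
  show "r div m < n" using assms by (rule less_mult_imp_div_less)
  show "r mod m < m" using assms by (cases m) auto
qed

lemma flip_index_less: "r < n * m \<Longrightarrow> flip_index m n r < m * n"
  unfolding flip_index_def by (intro tensor_index_less div_mod_less)

lemma flip_index_div_mod:
  assumes "r < n * m"
  shows "flip_index m n r div n = r mod m" "flip_index m n r mod n = r div m"
  using div_mod_less[OF assms] by (simp_all add: flip_index_def)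

lemma flip_index_flip_index:
  assumes "r < n * m"
  shows "flip_index n m (flip_index m n r) = r"
  using flip_index_div_mod[OF assms] by (simp add: flip_index_def[of n m])

lemma bij_betw_flip_index: "bij_betw (flip_index m n) {..<n * m} {..<m * n}"
  by (rule bij_betw_byWitness[where f' = "flip_index n m"])
    (auto simp: flip_index_less flip_index_flip_index)

lemma flip_carrier [simp]: "flip m n X \<in> carrier_mat (n * m) (n * m)"
  by (simp add: flip_def)

lemma index_flip:
  "r < n * m \<Longrightarrow> s < n * m \<Longrightarrow> flip m n X $$ (r, s) = X $$ (flip_index m n r, flip_index m n s)"
  by (simp add: flip_def)

lemma flip_flip:
  assumes "X \<in> carrier_mat (m * n) (m * n)"
  shows "flip n m (flip m n X) = X"
  using assms
  by (intro eq_matI)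
    (auto simp: index_flip flip_index_less flip_index_flip_index
      carrier_matD[OF flip_carrier])

lemma quadratic_form_sum:
  assumes "A \<in> carrier_mat d d" "v \<in> carrier_vec d"
  shows "(A *\<^sub>v v) \<bullet>c v = (\<Sum>r<d. (\<Sum>s<d. A $$ (r, s) * v $ s) * cnj (v $ r))"
  using assms by (auto simp: scalar_prod_def row_def atLeast0LessThan intro!: sum.cong)

text \<open>The value of the quadratic form of the flipped matrix at \<open>v\<close> is the value of the original
  form at \<open>v\<close> with its coordinates permuted.\<close>

lemma flip_psd:
  assumes "X \<in> psd (m * n)"
  shows "flip m n X \<in> psd (n * m)"
proof -
  have X: "X \<in> carrier_mat (m * n) (m * n)" using assms by (simp add: psd_def)
  have "0 \<le> (flip m n X *\<^sub>v v) \<bullet>c v" if v: "v \<in> carrier_vec (n * m)" for v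
  proof -
    let ?\<pi> = "flip_index m n"
    define w where "w = vec (m * n) (\<lambda>t. v $ flip_index n m t)"
    have w: "w \<in> carrier_vec (m * n)" by (simp add: w_def)
    have wv: "w $ ?\<pi> r = v $ r" if "r < n * m" for r
      using that by (simp add: w_def flip_index_less flip_index_flip_index)
    have "(X *\<^sub>v w) \<bullet>c w = (\<Sum>r<m * n. (\<Sum>s<m * n. X $$ (r, s) * w $ s) * cnj (w $ r))"
      by (rule quadratic_form_sum[OF X w])
    also have "\<dots> = (\<Sum>r<n * m. (\<Sum>s<m * n. X $$ (?\<pi> r, s) * w $ s) * cnj (w $ ?\<pi> r))"
      by (rule sum.reindex_bij_betw[OF bij_betw_flip_index, symmetric])
    also have "\<dots> = (\<Sum>r<n * m. (\<Sum>s<n * m. X $$ (?\<pi> r, ?\<pi> s) * w $ ?\<pi> s) * cnj (w $ ?\<pi> r))"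
      by (intro sum.cong refl arg_cong2[where f = "(*)"]
          sum.reindex_bij_betw[OF bij_betw_flip_index, symmetric])
    also have "\<dots> = (\<Sum>r<n * m. (\<Sum>s<n * m. flip m n X $$ (r, s) * v $ s) * cnj (v $ r))"
      by (simp add: index_flip wv)
    also have "\<dots> = (flip m n X *\<^sub>v v) \<bullet>c v"
      by (rule quadratic_form_sum[OF flip_carrier v, symmetric])
    finally show ?thesis using assms w by (auto simp: psd_def)
  qed
  then show ?thesis by (simp add: psd_def)
qed

lemma index_kron:
  assumes "A \<in> carrier_mat m m" "B \<in> carrier_mat n n" "r < m * n" "s < m * n"
  shows "(A \<otimes>\<^sub>K B) $$ (r, s) = A $$ (r div n, s div n) * B $$ (r mod n, s mod n)"
  using assms by (auto simp: kron_def)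

lemma flip_kron:
  assumes A: "A \<in> carrier_mat m m" and B: "B \<in> carrier_mat n n"
  shows "flip m n (A \<otimes>\<^sub>K B) = B \<otimes>\<^sub>K A"
  using kron_carrier[OF B A]
  by (intro eq_matI)
    (auto simp: index_flip index_kron[OF A B] index_kron[OF B A] flip_index_less
      flip_index_div_mod carrier_matD[OF flip_carrier])

lemma flip_finsum:
  assumes "finite I" and f: "\<And>i. i \<in> I \<Longrightarrow> f i \<in> carrier_mat (m * n) (m * n)"
  shows "flip m n (\<Oplus>\<^bsub>matrix_space (m * n)\<^esub> i \<in> I. f i)
    = (\<Oplus>\<^bsub>matrix_space (n * m)\<^esub> i \<in> I. flip m n (f i))" (is "?L = ?R")
proof (rule eq_matI)
  have R: "?R \<in> carrier_mat (n * m) (n * m)"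
    using assms(1) by (rule finsum_mat_closed) simp
  then show "dim_row ?L = dim_row ?R" "dim_col ?L = dim_col ?R"
    by (simp_all add: carrier_matD[OF flip_carrier])
  fix r s assume "r < dim_row ?R" "s < dim_col ?R"
  then have rs: "r < n * m" "s < n * m" using R by auto
  have "?L $$ (r, s) = (\<Sum>i\<in>I. f i $$ (flip_index m n r, flip_index m n s))"
    using rs assms by (simp add: index_flip index_finsum_mat flip_index_less)
  also have "\<dots> = (\<Sum>i\<in>I. flip m n (f i) $$ (r, s))"
    using rs by (simp add: index_flip)
  also have "\<dots> = ?R $$ (r, s)"
    using rs assms(1) by (simp add: index_finsum_mat)
  finally show "?L $$ (r, s) = ?R $$ (r, s)" .
qed

lemma flip_separable:
  assumes "X \<in> separable m n"
  shows "flip m n X \<in> separable n m"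
proof -
  from assms obtain N :: nat and A B where
    X: "X \<in> psd (m * n)" and AB: "\<forall>i<N. A i \<in> psd m \<and> B i \<in> psd n"
    and sum: "X = (\<Oplus>\<^bsub>matrix_space (m * n)\<^esub> i \<in> {..<N}. A i \<otimes>\<^sub>K B i)"
    by (auto simp: separable_def)
  have carr: "A i \<in> carrier_mat m m" "B i \<in> carrier_mat n n" if "i < N" for i
    using AB that by (auto simp: psd_def)
  interpret abelian_group "matrix_space (n * m)" by (rule abelian_group_mat)
  have "flip m n X = (\<Oplus>\<^bsub>matrix_space (n * m)\<^esub> i \<in> {..<N}. flip m n (A i \<otimes>\<^sub>K B i))"
    unfolding sum by (rule flip_finsum) (auto intro: kron_carrier carr)
  also have "\<dots> = (\<Oplus>\<^bsub>matrix_space (n * m)\<^esub> i \<in> {..<N}. B i \<otimes>\<^sub>K A i)"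
    by (rule finsum_cong')
      (auto simp: flip_kron carr module_mat_simps intro!: kron_carrier)
  finally show ?thesis
    using flip_psd[OF X] AB unfolding separable_def by blast
qed

lemma index_tensor_map:
  assumes \<Phi>: "\<And>i j. \<Phi> (matrix_unit a i j) \<in> carrier_mat b b"
    and \<Psi>: "\<And>p q. \<Psi> (matrix_unit c p q) \<in> carrier_mat d d"
    and rs: "r < b * d" "s < b * d"
  shows "tensor_map a b \<Phi> c d \<Psi> X $$ (r, s) = (\<Sum>i<a. \<Sum>j<a. \<Sum>p<c. \<Sum>q<c.
    X $$ (i * c + p, j * c + q) * (\<Phi> (matrix_unit a i j) $$ (r div d, s div d) *
      \<Psi> (matrix_unit c p q) $$ (r mod d, s mod d)))"
proof -
  let ?I = "{..<a} \<times> {..<a} \<times> {..<c} \<times> {..<c}"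
  let ?f = "\<lambda>(i, j, p, q). X $$ (i * c + p, j * c + q) \<cdot>\<^sub>m
      (\<Phi> (matrix_unit a i j) \<otimes>\<^sub>K \<Psi> (matrix_unit c p q))"
  have K: "\<Phi> (matrix_unit a i j) \<otimes>\<^sub>K \<Psi> (matrix_unit c p q) \<in> carrier_mat (b * d) (b * d)"
    for i j p q using \<Phi> \<Psi> by (rule kron_carrier)
  have f: "?f x \<in> carrier_mat (b * d) (b * d)" for x
    using K by (auto split: prod.split)
  have "tensor_map a b \<Phi> c d \<Psi> X $$ (r, s) = (\<Sum>x\<in>?I. ?f x $$ (r, s))"
    unfolding tensor_map_def by (rule index_finsum_mat) (use f rs in auto)
  also have "\<dots> = (\<Sum>(i, j, p, q)\<in>?I. X $$ (i * c + p, j * c + q) *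
      (\<Phi> (matrix_unit a i j) $$ (r div d, s div d) *
        \<Psi> (matrix_unit c p q) $$ (r mod d, s mod d)))"
    using rs by (intro sum.cong)
      (auto simp: index_kron[OF \<Phi> \<Psi>] carrier_matD[OF K])
  finally show ?thesis by (simp add: sum.cartesian_product[symmetric])
qed

lemma tensor_map_carrier:
  assumes "\<And>i j. \<Phi> (matrix_unit a i j) \<in> carrier_mat b b"
    and "\<And>p q. \<Psi> (matrix_unit c p q) \<in> carrier_mat d d"
  shows "tensor_map a b \<Phi> c d \<Psi> X \<in> carrier_mat (b * d) (b * d)"
  unfolding tensor_map_def
  by (rule finsum_mat_closed) (use assms in \<open>auto intro!: smult_carrier_mat kron_carrier\<close>)

text \<open>Both sides expand over the basis \<open>E\<^sub>i\<^sub>j \<otimes> E\<^sub>p\<^sub>q\<close>. Their terms agree, since the coefficient of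
  \<open>E\<^sub>p\<^sub>q \<otimes> E\<^sub>i\<^sub>j\<close> in the flip of \<open>X\<close> is that of \<open>E\<^sub>i\<^sub>j \<otimes> E\<^sub>p\<^sub>q\<close> in \<open>X\<close>, and the flip of
  \<open>\<Phi>(E\<^sub>i\<^sub>j) \<otimes> \<Psi>(E\<^sub>p\<^sub>q)\<close> is \<open>\<Psi>(E\<^sub>p\<^sub>q) \<otimes> \<Phi>(E\<^sub>i\<^sub>j)\<close>. What remains is the order of summation.\<close>

lemma flip_tensor_map:
  assumes \<Phi>: "\<And>i j. \<Phi> (matrix_unit a i j) \<in> carrier_mat b b"
    and \<Psi>: "\<And>p q. \<Psi> (matrix_unit c p q) \<in> carrier_mat d d"
  shows "flip b d (tensor_map a b \<Phi> c d \<Psi> X) = tensor_map c d \<Psi> a b \<Phi> (flip a c X)"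
    (is "?L = ?R")
proof (rule eq_matI)
  have R: "?R \<in> carrier_mat (d * b) (d * b)"
    using \<Psi> \<Phi> by (rule tensor_map_carrier)
  then show "dim_row ?L = dim_row ?R" "dim_col ?L = dim_col ?R"
    by (simp_all add: carrier_matD[OF flip_carrier])
  fix r s assume "r < dim_row ?R" "s < dim_col ?R"
  then have rs: "r < d * b" "s < d * b" using R by auto
  let ?x = "\<lambda>i j p q. X $$ (i * c + p, j * c + q)"
  let ?u = "\<lambda>i j. \<Phi> (matrix_unit a i j) $$ (r mod b, s mod b)"
  let ?v = "\<lambda>p q. \<Psi> (matrix_unit c p q) $$ (r div b, s div b)"
  have coeff: "flip a c X $$ (p * a + i, q * a + j) = ?x i j p q"
    if "i < a" "j < a" "p < c" "q < c" for i j p q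
    using that by (simp add: index_flip tensor_index_less flip_index_def)
  have "?L $$ (r, s) = (\<Sum>i<a. \<Sum>j<a. \<Sum>p<c. \<Sum>q<c. ?x i j p q * (?u i j * ?v p q))"
    using rs by (simp add: index_flip index_tensor_map[where \<Phi> = \<Phi> and \<Psi> = \<Psi>, OF \<Phi> \<Psi>] flip_index_less
      flip_index_div_mod)
  also have "\<dots> = (\<Sum>(i, j) \<in> {..<a} \<times> {..<a}. \<Sum>(p, q) \<in> {..<c} \<times> {..<c}.
      ?x i j p q * (?u i j * ?v p q))"
    by (simp add: sum.cartesian_product[symmetric])
  also have "\<dots> = (\<Sum>(p, q) \<in> {..<c} \<times> {..<c}. \<Sum>(i, j) \<in> {..<a} \<times> {..<a}.
      ?x i j p q * (?u i j * ?v p q))"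
    unfolding split_def by (rule sum.swap)
  also have "\<dots> = (\<Sum>p<c. \<Sum>q<c. \<Sum>i<a. \<Sum>j<a. ?x i j p q * (?u i j * ?v p q))"
    by (simp add: sum.cartesian_product[symmetric])
  also have "\<dots> = ?R $$ (r, s)"
    unfolding index_tensor_map[where \<Phi> = \<Psi> and \<Psi> = \<Phi>, OF \<Psi> \<Phi> rs]
    by (intro sum.cong refl) (simp add: coeff mult.commute)
  finally show "?L $$ (r, s) = ?R $$ (r, s)" .
qed

theorem theorem3p10:
  fixes d1 d2 k :: nat and \<Phi> :: "complex mat \<Rightarrow> complex mat"
  assumes "k \<ge> 1"
    and "linear_map class_ring (matrix_space d1) (matrix_space d2) \<Phi>"
    and "k_positive k d1 d2 \<Phi>"
  shows "k_entanglement_breaking k d1 d2 \<Phi> \<longleftrightarrow>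
    (\<forall>X \<in> psd (d1 * k). tensor_map d1 d2 \<Phi> k k id X \<in> separable d2 k)"
proof -
  interpret L: linear_map class_ring "matrix_space d1" "matrix_space d2" \<Phi> by (rule assms(2))
  have \<Phi>: "\<Phi> (matrix_unit d1 i j) \<in> carrier_mat d2 d2" for i j
    using L.T_im[of "matrix_unit d1 i j"] by (simp add: module_mat_simps)
  have I: "id (matrix_unit k p q) \<in> carrier_mat k k" for p q by simp
  let ?left = "tensor_map k k id d1 d2 \<Phi>" and ?right = "tensor_map d1 d2 \<Phi> k k id"
  show ?thesis
  proof
    assume eb: "k_entanglement_breaking k d1 d2 \<Phi>"
    show "\<forall>X \<in> psd (d1 * k). ?right X \<in> separable d2 k"
    proof
      fix X assume X: "X \<in> psd (d1 * k)"
      have "?right X = ?right (flip k d1 (flip d1 k X))"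
        using X by (simp add: flip_flip psd_def)
      also have "\<dots> = flip k d2 (?left (flip d1 k X))"
        by (rule flip_tensor_map[where \<Phi> = id and \<Psi> = \<Phi>, OF I \<Phi>, symmetric])
      also have "\<dots> \<in> separable d2 k"
        using eb flip_psd[OF X] by (auto simp: k_entanglement_breaking_def intro: flip_separable)
      finally show "?right X \<in> separable d2 k" .
    qed
  next
    assume sep: "\<forall>X \<in> psd (d1 * k). ?right X \<in> separable d2 k"
    have "?left X \<in> separable k d2" if X: "X \<in> psd (k * d1)" for X
    proof -
      have "?left X = ?left (flip d1 k (flip k d1 X))"
        using X by (simp add: flip_flip psd_def)
      also have "\<dots> = flip d2 k (?right (flip k d1 X))"
        by (rule flip_tensor_map[where \<Phi> = \<Phi> and \<Psi> = id, OF \<Phi> I, symmetric])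
      also have "\<dots> \<in> separable k d2"
        using sep flip_psd[OF X] by (auto intro: flip_separable)
      finally show ?thesis .
    qed
    then show "k_entanglement_breaking k d1 d2 \<Phi>"
      using assms(3) by (simp add: k_entanglement_breaking_def)
  qed
qed

end
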